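(* Let $p$ be an integer with $p\ge 3$ and let $H$ be a simple graph of order $p+4$ not containing $B_p$ as a subgraph. Then $H$ has size $\mathrm{ex}(p+4,B_p)$ if and only if $H=\overline{K_2+C_{i_1}+C_{i_2}+\cdots+C_{i_t}}$ where $i_j\ne 4$ for each $j$ and $i_1+i_2+\cdots+i_t=p+2$.
   Context: Graphs are finite and simple; equality of graphs means isomorphism. The book $B_p$ is the graph consisting of $p$ triangles sharing a common edge. For a graph $H$ and positive integer $n$, $\mathrm{ex}(n,H)$ is the maximum number of edges of a simple graph of order $n$ not containing $H$ as a subgraph. $+$ denotes disjoint union, $\overline{G}$ the complement, $K_2$ a single edge, and $C_s$ the cycle of length $s$ ($s\ge 3$). *)

theory Defs
  imports "Graph_Theory.Graph_Theory"
begin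

text \<open>
  A finite simple graph is a \<open>pair_graph\<close>: a finite, loop-free, symmetric set of arcs on a finite
  vertex set. Equality of graphs up to isomorphism is \<open>digraph_iso\<close>, which for such graphs is the
  existence of an adjacency-preserving bijection (lemma \<open>digraph_iso_pair_iff\<close> below).
\<close>

definition order_of :: "'a pair_pre_digraph \<Rightarrow> nat" where
  "order_of G = card (pverts G)"

text \<open>An undirected edge \<open>uv\<close> is present as the two arcs \<open>(u,v)\<close> and \<open>(v,u)\<close>, counted once.\<close>

definition size_of :: "'a pair_pre_digraph \<Rightarrow> nat" where
  "size_of G = card {{u, v} | u v. (u, v) \<in> parcs G}"

definition contains_subgraph :: "'a pair_pre_digraph \<Rightarrow> 'b pair_pre_digraph \<Rightarrow> bool" where
  "contains_subgraph G F \<longleftrightarrow>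
     (\<exists>K :: 'a pair_pre_digraph. subgraph (with_proj K) (with_proj G)
        \<and> digraph_iso (with_proj K) (with_proj F))"

text \<open>Every finite graph has an isomorphic copy with vertices in \<open>nat\<close>, so it suffices to let the
  host graphs range over these. The maximum exists whenever \<open>F\<close> has an edge.\<close>

definition ex_number :: "nat \<Rightarrow> 'b pair_pre_digraph \<Rightarrow> nat" where
  "ex_number n F = Max {size_of G | G :: nat pair_pre_digraph.
     pair_graph G \<and> order_of G = n \<and> \<not> contains_subgraph G F}"

definition complement_graph :: "'a pair_pre_digraph \<Rightarrow> 'a pair_pre_digraph" where
  "complement_graph G = \<lparr> pverts = pverts G,
     parcs = {(u, v). u \<in> pverts G \<and> v \<in> pverts G \<and> u \<noteq> v \<and> (u, v) \<notin> parcs G} \<rparr>"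

text \<open>The disjoint union of a list of graphs; vertices are tagged by the position in the list.\<close>

definition disjoint_union :: "'a pair_pre_digraph list \<Rightarrow> (nat \<times> 'a) pair_pre_digraph" where
  "disjoint_union Gs = \<lparr> pverts = {(k, u). k < length Gs \<and> u \<in> pverts (Gs ! k)},
     parcs = {((k, u), (k, v)) | k u v. k < length Gs \<and> (u, v) \<in> parcs (Gs ! k)} \<rparr>"

definition complete_graph :: "nat \<Rightarrow> nat pair_pre_digraph" where
  "complete_graph n = \<lparr> pverts = {..<n}, parcs = {(u, v). u < n \<and> v < n \<and> u \<noteq> v} \<rparr>"

text \<open>Meaningful for \<open>s \<ge> 3\<close> only.\<close>

definition cycle_graph :: "nat \<Rightarrow> nat pair_pre_digraph" where
  "cycle_graph s = \<lparr> pverts = {..<s},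
     parcs = {(u, v). u < s \<and> v < s \<and> (v = Suc u mod s \<or> u = Suc v mod s)} \<rparr>"

text \<open>The triangles are \<open>{0, 1, k + 2}\<close> for \<open>k < p\<close>; their common edge is \<open>{0, 1}\<close>.\<close>

definition book_graph :: "nat \<Rightarrow> nat pair_pre_digraph" where
  "book_graph p = \<lparr> pverts = (\<Union>k<p. {0, 1, k + 2}),
     parcs = (\<Union>k<p. {(u, v). u \<in> {0, 1, k + 2} \<and> v \<in> {0, 1, k + 2} \<and> u \<noteq> v}) \<rparr>"

lemma pair_graph_complement_graph:
  assumes "pair_graph G"
  shows "pair_graph (complement_graph G)"
proof -
  interpret pair_graph G by fact
  have "finite (pverts G \<times> pverts G)" using pair_finite_verts by blast
  then have "finite (parcs (complement_graph G))"
    by (rule rev_finite_subset) (auto simp: complement_graph_def)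
  moreover have "(v, u) \<in> parcs G \<longleftrightarrow> (u, v) \<in> parcs G" for u v
    using pair_sym_arcs by (auto simp: symmetric_def dest: symD)
  ultimately show ?thesis using pair_finite_verts
    by unfold_locales (auto simp: complement_graph_def symmetric_def intro!: symI)
qed

lemma pair_graph_complete_graph: "pair_graph (complete_graph n)"
proof -
  have "finite {(u, v). u < n \<and> v < n \<and> u \<noteq> v}"
    by (rule finite_subset[of _ "{..<n} \<times> {..<n}"]) auto
  then show ?thesis
    by unfold_locales (auto simp: complete_graph_def symmetric_def intro!: symI)
qed

lemma pair_graph_cycle_graph:
  assumes "s \<ge> 3"
  shows "pair_graph (cycle_graph s)"
proof -
  have "finite {(u, v). u < s \<and> v < s \<and> (v = Suc u mod s \<or> u = Suc v mod s)}"
    by (rule finite_subset[of _ "{..<s} \<times> {..<s}"]) auto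
  moreover have "Suc u mod s \<noteq> u" "u \<noteq> Suc u mod s" if "u < s" for u
    using assms that by (cases "Suc u = s"; auto)+
  ultimately show ?thesis
    by unfold_locales (auto simp: cycle_graph_def symmetric_def intro!: symI)
qed

lemma pair_graph_book_graph: "pair_graph (book_graph p)"
proof -
  have fin: "finite (pverts (book_graph p))" by (simp add: book_graph_def)
  have sub: "(u, v) \<in> parcs (book_graph p) \<Longrightarrow>
    u \<in> pverts (book_graph p) \<and> v \<in> pverts (book_graph p) \<and> u \<noteq> v \<and> (v, u) \<in> parcs (book_graph p)" for u v
    unfolding book_graph_def by fastforce
  have "finite (parcs (book_graph p))"
    by (rule finite_subset[of _ "pverts (book_graph p) \<times> pverts (book_graph p)"])
      (use sub fin in auto)
  with fin show ?thesis
    by unfold_locales (use sub in \<open>auto simp: symmetric_def intro!: symI\<close>)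
qed

lemma pair_graph_disjoint_union:
  assumes "\<And>G. G \<in> set Gs \<Longrightarrow> pair_graph G"
  shows "pair_graph (disjoint_union Gs)"
proof -
  have pg: "pair_graph (Gs ! k)" if "k < length Gs" for k using assms that by auto
  have wf: "u \<in> pverts (Gs ! k)" "v \<in> pverts (Gs ! k)" "u \<noteq> v" "(v, u) \<in> parcs (Gs ! k)"
    if "k < length Gs" "(u, v) \<in> parcs (Gs ! k)" for k u v
  proof -
    interpret pair_graph "Gs ! k" using pg that by blast
    show "u \<in> pverts (Gs ! k)" "v \<in> pverts (Gs ! k)" using that by (auto dest: in_arcsD1 in_arcsD2)
    show "u \<noteq> v" using pair_no_loops[OF that(2)] by simp
    show "(v, u) \<in> parcs (Gs ! k)" using pair_sym_arcs that
      by (auto simp: symmetric_def dest: symD)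
  qed
  have eq: "pverts (disjoint_union Gs) = (SIGMA k:{..<length Gs}. pverts (Gs ! k))"
    by (auto simp: disjoint_union_def)
  have fin: "finite (pverts (disjoint_union Gs))" unfolding eq
    using pg by (auto intro!: finite_SigmaI pair_fin_digraph.pair_finite_verts
      simp: pair_graph_def pair_digraph_def)
  have "finite (pverts (disjoint_union Gs) \<times> pverts (disjoint_union Gs))" using fin by blast
  then have "finite (parcs (disjoint_union Gs))"
    by (rule rev_finite_subset) (auto simp: disjoint_union_def wf)
  with fin show ?thesis
    by unfold_locales (auto simp: disjoint_union_def symmetric_def wf intro!: symI)
qed

lemma digraph_iso_pair_iff:
  fixes G :: "'a pair_pre_digraph" and H :: "'b pair_pre_digraph"
  assumes "pair_graph G" and "pair_graph H"
  shows "digraph_iso (with_proj G) (with_proj H) \<longleftrightarrow>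
    (\<exists>f. bij_betw f (pverts G) (pverts H) \<and>
      (\<forall>u\<in>pverts G. \<forall>v\<in>pverts G. (u, v) \<in> parcs G \<longleftrightarrow> (f u, f v) \<in> parcs H))"
proof
  interpret G: pair_graph G by fact
  interpret H: pair_graph H by fact
  assume "digraph_iso (with_proj G) (with_proj H)"
  then obtain h where h: "pre_digraph.digraph_isomorphism (with_proj G) h"
    and H: "with_proj H = app_iso h (with_proj G)" by (auto simp: digraph_iso_def)
  let ?f = "iso_verts h"
  have pv: "pverts H = ?f ` pverts G" and pa: "parcs H = iso_arcs h ` parcs G"
    and t: "iso_tail h = fst" and hd: "iso_head h = snd"
    using arg_cong[OF H, of verts] arg_cong[OF H, of arcs]
      arg_cong[OF H, of tail] arg_cong[OF H, of head] by auto
  have inj: "inj_on ?f (pverts G)"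
    and arc: "\<And>a. a \<in> parcs G \<Longrightarrow> iso_arcs h a = (?f (fst a), ?f (snd a))"
    using h t hd by (auto simp: G.digraph_isomorphism_def prod_eq_iff)
  have "(u, v) \<in> parcs G \<longleftrightarrow> (?f u, ?f v) \<in> parcs H" if "u \<in> pverts G" "v \<in> pverts G" for u v
  proof
    assume "(u, v) \<in> parcs G" then show "(?f u, ?f v) \<in> parcs H"
      using arc[of "(u, v)"] by (force simp: pa)
  next
    assume "(?f u, ?f v) \<in> parcs H"
    then obtain x y where xy: "(x, y) \<in> parcs G" "iso_arcs h (x, y) = (?f u, ?f v)"
      by (auto simp: pa)
    then have "?f x = ?f u" "?f y = ?f v" using arc by auto
    with xy that inj show "(u, v) \<in> parcs G"
      by (metis G.in_arcsD1 G.in_arcsD2 inj_onD)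
  qed
  then show "\<exists>f. bij_betw f (pverts G) (pverts H) \<and>
      (\<forall>u\<in>pverts G. \<forall>v\<in>pverts G. (u, v) \<in> parcs G \<longleftrightarrow> (f u, f v) \<in> parcs H)"
    using inj pv by (auto simp: bij_betw_def)
next
  interpret G: pair_graph G by fact
  interpret H: pair_graph H by fact
  assume "\<exists>f. bij_betw f (pverts G) (pverts H) \<and>
      (\<forall>u\<in>pverts G. \<forall>v\<in>pverts G. (u, v) \<in> parcs G \<longleftrightarrow> (f u, f v) \<in> parcs H)"
  then obtain f where f: "bij_betw f (pverts G) (pverts H)"
    and e: "\<And>u v. u \<in> pverts G \<Longrightarrow> v \<in> pverts G \<Longrightarrow> (u, v) \<in> parcs G \<longleftrightarrow> (f u, f v) \<in> parcs H"
    by blast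
  define h where "h = \<lparr> iso_verts = f, iso_arcs = map_prod f f, iso_head = snd, iso_tail = fst \<rparr>"
  have inj: "inj_on f (pverts G)" and im: "f ` pverts G = pverts H"
    using f by (auto simp: bij_betw_def)
  have "inj_on (map_prod f f) (parcs G)"
  proof (rule inj_onI)
    fix a b assume "a \<in> parcs G" "b \<in> parcs G" "map_prod f f a = map_prod f f b"
    then show "a = b"
      using inj by (cases a; cases b) (metis G.in_arcsD1 G.in_arcsD2 inj_onD map_prod_simp prod.inject)
  qed
  then have "pre_digraph.digraph_isomorphism (with_proj G) h"
    using inj G.wf_digraph by (auto simp: G.digraph_isomorphism_def h_def)
  moreover have "parcs H = map_prod f f ` parcs G"
  proof (intro equalityI subsetI)
    fix a assume a: "a \<in> parcs H"
    then obtain x y where "x \<in> pverts G" "y \<in> pverts G" "a = (f x, f y)"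
      using im by (cases a) (metis H.in_arcsD1 H.in_arcsD2 imageE)
    with a e show "a \<in> map_prod f f ` parcs G" by force
  next
    fix a assume "a \<in> map_prod f f ` parcs G"
    then show "a \<in> parcs H" using e by (auto dest: G.in_arcsD1 G.in_arcsD2)
  qed
  then have "with_proj H = app_iso h (with_proj G)"
    by (simp add: with_proj_def app_iso_def h_def im)
  ultimately show "digraph_iso (with_proj G) (with_proj H)" by (auto simp: digraph_iso_def)
qed

end

theory Submission
  imports Defs
begin

text \<open>
  Let \<open>F\<close> be the complement of a graph on \<open>n = p + 4\<close> vertices. Two vertices that are not adjacent in
  \<open>F\<close> span an edge of the graph lying in \<open>p + 2 - |N(x) \<union> N(y)|\<close> triangles, with neighbourhoods taken
  in \<open>F\<close>, so the graph is \<open>B\<^sub>p\<close>-free iff \<open>|N(x) \<union> N(y)| \<ge> 3\<close> for all distinct non-adjacent \<open>x, y\<close>.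
  The degree sum of \<open>F\<close> is then at least \<open>2n - 2\<close>. This is clear if all degrees are at least 2, or if
  some vertex is isolated, since then all others have degree at least 3. If \<open>x\<close> has the single
  neighbour \<open>z\<close>, of degree \<open>d\<close>, then every further vertex has degree at least 2, and at least 3 if it is
  adjacent to \<open>z\<close>, so that the sum is at least \<open>2n - 4 + 2d\<close>. Equality forces \<open>d = 1\<close> and all other
  degrees equal to 2, that is, \<open>K\<^sub>2\<close> plus a disjoint union of cycles; opposite vertices of a 4-cycle
  violate the condition. Equality is attained by \<open>K\<^sub>2 + C\<close> with \<open>C\<close> a cycle of length \<open>p + 2 \<ge> 5\<close>.
\<close>

section \<open>Counting arcs of a graph and of its complement\<close>

lemma pair_graph_iff:
  "pair_graph G \<longleftrightarrow> finite (pverts G) \<and> parcs G \<subseteq> pverts G \<times> pverts G \<and>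
     sym (parcs G) \<and> (\<forall>v. (v, v) \<notin> parcs G)"
proof
  assume "pair_graph G"
  then interpret pair_graph G .
  show "finite (pverts G) \<and> parcs G \<subseteq> pverts G \<times> pverts G \<and>
     sym (parcs G) \<and> (\<forall>v. (v, v) \<notin> parcs G)"
    using pair_finite_verts pair_sym_arcs
    by (auto simp: symmetric_def dest: in_arcsD1 in_arcsD2 pair_no_loops)
next
  assume *: "finite (pverts G) \<and> parcs G \<subseteq> pverts G \<times> pverts G \<and>
     sym (parcs G) \<and> (\<forall>v. (v, v) \<notin> parcs G)"
  then have "finite (parcs G)"
    by (meson finite_SigmaI finite_subset)
  with * show "pair_graph G"
    by unfold_locales (auto simp: symmetric_def)
qed

text \<open>Arcs come in opposite pairs and loops are absent, so the map from an arc to its set of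
  ends has fibres of size two.\<close>

lemma card_parcs:
  assumes "pair_graph G"
  shows "card (parcs G) = 2 * size_of G"
proof -
  let ?e = "\<lambda>a :: 'a \<times> 'a. {fst a, snd a}"
  have G: "finite (pverts G)" "parcs G \<subseteq> pverts G \<times> pverts G" "sym (parcs G)"
    "\<And>v. (v, v) \<notin> parcs G"
    using assms by (auto simp: pair_graph_iff)
  then have fin: "finite (parcs G)"
    by (meson finite_SigmaI finite_subset)
  have edges: "{{u, v} | u v. (u, v) \<in> parcs G} = ?e ` parcs G"
    by force
  have fibre: "card {a \<in> parcs G. ?e a = e} = 2" if e: "e \<in> ?e ` parcs G" for e
  proof -
    from e obtain u v where uv: "(u, v) \<in> parcs G" "e = {u, v}"
      by auto
    then have "{a \<in> parcs G. ?e a = e} = {(u, v), (v, u)}"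
      using G(3) by (auto simp: doubleton_eq_iff dest: symD)
    moreover have "u \<noteq> v" using uv G(4) by auto
    ultimately show ?thesis by simp
  qed
  have "card (parcs G) = (\<Sum>e\<in>?e ` parcs G. card {a \<in> parcs G. ?e a = e})"
    using sum.image_gen[OF fin, of "\<lambda>_. 1 :: nat" ?e] by simp
  also have "\<dots> = 2 * card (?e ` parcs G)"
    using fibre by simp
  finally show ?thesis
    by (simp add: size_of_def edges)
qed

lemma card_parcs_complement_graph:
  assumes "pair_graph G"
  shows "card (parcs G) + card (parcs (complement_graph G)) = order_of G * (order_of G - 1)"
proof -
  let ?V = "pverts G"
  have G: "finite ?V" "parcs G \<subseteq> ?V \<times> ?V" "\<And>v. (v, v) \<notin> parcs G"
    using assms by (auto simp: pair_graph_iff)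
  have un: "parcs G \<union> parcs (complement_graph G) = (SIGMA u:?V. ?V - {u})"
    using G by (auto simp: complement_graph_def)
  have "finite (parcs G \<union> parcs (complement_graph G))"
    unfolding un using G(1) by auto
  then have "card (parcs G) + card (parcs (complement_graph G)) = card (SIGMA u:?V. ?V - {u})"
    unfolding un[symmetric] by (intro card_Un_disjoint[symmetric]) (auto simp: complement_graph_def)
  also have "\<dots> = order_of G * (order_of G - 1)"
    using G(1) by (simp add: order_of_def card_SigmaI)
  finally show ?thesis .
qed

lemma complement_graph_complement_graph:
  assumes "pair_graph G"
  shows "complement_graph (complement_graph G) = G"
  using assms unfolding pair_graph_iff complement_graph_def
  by (intro pair_pre_digraph.equality) auto

lemma card_eq_sum_Image:
  assumes "finite V" "E \<subseteq> V \<times> V"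
  shows "card E = (\<Sum>v\<in>V. card (E `` {v}))"
proof -
  have "E = (SIGMA v:V. E `` {v})" using assms by auto
  moreover have "finite (E `` {v})" for v
    using assms by (meson finite_Image finite_SigmaI finite_subset)
  ultimately show ?thesis using assms by (metis card_SigmaI)
qed

section \<open>Books as common neighbourhoods\<close>

text \<open>A copy of the book is an edge, the image of the spine \<open>{0, 1}\<close>, together
  with \<open>p\<close> common neighbours of its ends. Vertices and arcs of
  \<open>book_graph\<close> are unions over \<open>k < p\<close>, so \<open>p \<ge> 1\<close> is
  what puts the spine into it.\<close>

lemma contains_book_graph_iff:
  fixes G :: "'a pair_pre_digraph"
  assumes G: "pair_graph G" and p: "p \<ge> 1"
  shows "contains_subgraph G (book_graph p) \<longleftrightarrow>
    (\<exists>u v. (u, v) \<in> parcs G \<and> p \<le> card (parcs G `` {u} \<inter> parcs G `` {v}))"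
proof
  interpret G: pair_graph G by fact
  note G' = G[unfolded pair_graph_iff]
  have fin: "finite (parcs G `` A)" for A
    using G' by (meson finite_Image finite_SigmaI finite_subset Image_subset)
  assume "contains_subgraph G (book_graph p)"
  then obtain K :: "'a pair_pre_digraph" where sub: "subgraph (with_proj K) (with_proj G)"
    and iso: "digraph_iso (with_proj K) (with_proj (book_graph p))"
    by (auto simp: contains_subgraph_def)
  have wf: "wf_digraph (with_proj K)" and KG: "parcs K \<subseteq> parcs G"
    using sub by (auto simp: subgraph_def)
  interpret K: wf_digraph "with_proj K" by fact
  \<comment> \<open>\<open>K\<close> is known to be a well-formed digraph but not yet symmetric, so
    the isomorphism is unpacked by hand instead of through
    \<open>digraph_iso_pair_iff\<close>.\<close>
  from iso obtain h where h: "pre_digraph.digraph_isomorphism (with_proj K) h"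
    and H: "with_proj (book_graph p) = app_iso h (with_proj K)" by (auto simp: digraph_iso_def)
  let ?f = "iso_verts h"
  have pv: "pverts (book_graph p) = ?f ` pverts K"
    and pa: "parcs (book_graph p) = iso_arcs h ` parcs K"
    and t: "iso_tail h = fst" and hd: "iso_head h = snd"
    using arg_cong[OF H, of verts] arg_cong[OF H, of arcs]
      arg_cong[OF H, of tail] arg_cong[OF H, of head] by auto
  have inj: "inj_on ?f (pverts K)"
    and arc: "\<And>a. a \<in> parcs K \<Longrightarrow> iso_arcs h a = (?f (fst a), ?f (snd a))"
    using h t hd by (auto simp: K.digraph_isomorphism_def prod_eq_iff)
  let ?g = "inv_into (pverts K) ?f"
  have lift: "(?g i, ?g j) \<in> parcs G" if ij: "(i, j) \<in> parcs (book_graph p)" for i j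
  proof -
    obtain x y where xy: "(x, y) \<in> parcs K" "iso_arcs h (x, y) = (i, j)"
      using ij by (auto simp: pa)
    then have "x \<in> pverts K" "y \<in> pverts K" "?f x = i" "?f y = j"
      using K.wellformed arc by force+
    then have "?g i = x" "?g j = y" using inj by auto
    with xy KG show ?thesis by auto
  qed
  have inj_g: "inj_on ?g (pverts (book_graph p))"
    unfolding pv by (rule inj_on_inv_into) simp
  let ?W = "(\<lambda>k. k + 2) ` {..<p}"
  have "?W \<subseteq> pverts (book_graph p)" by (auto simp: book_graph_def)
  then have "card (?g ` ?W) = card ?W"
    using inj_g by (intro card_image) (rule inj_on_subset)
  also have "\<dots> = p"
    by (subst card_image) (auto simp: inj_on_def)
  finally have "card (?g ` ?W) = p" .
  moreover have "?g ` ?W \<subseteq> parcs G `` {?g 0} \<inter> parcs G `` {?g 1}"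
  proof
    fix w assume "w \<in> ?g ` ?W"
    then obtain k where "k < p" "w = ?g (k + 2)" by auto
    moreover from \<open>k < p\<close> have "(0, k + 2) \<in> parcs (book_graph p)" "(1, k + 2) \<in> parcs (book_graph p)"
      by (auto simp: book_graph_def)
    ultimately show "w \<in> parcs G `` {?g 0} \<inter> parcs G `` {?g 1}" using lift by auto
  qed
  ultimately have "p \<le> card (parcs G `` {?g 0} \<inter> parcs G `` {?g 1})"
    using fin by (metis card_mono finite_Int)
  moreover have "(0, 1) \<in> parcs (book_graph p)" using p by (auto simp: book_graph_def intro!: exI[of _ 0])
  ultimately show "\<exists>u v. (u, v) \<in> parcs G \<and> p \<le> card (parcs G `` {u} \<inter> parcs G `` {v})"
    using lift by blast
next
  interpret G: pair_graph G by fact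
  note G' = G[unfolded pair_graph_iff]
  assume "\<exists>u v. (u, v) \<in> parcs G \<and> p \<le> card (parcs G `` {u} \<inter> parcs G `` {v})"
  then obtain u v where uv: "(u, v) \<in> parcs G" "p \<le> card (parcs G `` {u} \<inter> parcs G `` {v})"
    by blast
  then obtain W where W: "W \<subseteq> parcs G `` {u} \<inter> parcs G `` {v}" "card W = p" "finite W"
    by (meson obtain_subset_with_card_n)
  then obtain g where g: "bij_betw g {..<p} W"
    using ex_bij_betw_nat_finite[of W] by (auto simp: atLeast0LessThan)
  \<comment> \<open>Vertices \<open>0\<close> and \<open>1\<close> go to the ends of the spine; the
    shift by two matches the page vertices \<open>k + 2\<close> of
    \<open>book_graph\<close>.\<close>
  define f where "f i = (if i = 0 then u else if i = 1 then v else g (i - 2))" for i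
  have f[simp]: "f 0 = u" "f (Suc 0) = v" "f (Suc (Suc k)) = g k" for k
    by (simp_all add: f_def)
  have gW: "g k \<in> W" if "k < p" for k using g that by (auto simp: bij_betw_def)
  have g_inj: "g k = g l \<Longrightarrow> k = l" if "k < p" "l < p" for k l
    using g that by (auto simp: bij_betw_def inj_on_def)
  have un: "u \<notin> W" "v \<notin> W" "u \<noteq> v" using W uv G' by auto
  let ?B = "book_graph p"
  have pvB: "pverts ?B = {..<p + 2}"
  proof (rule set_eqI)
    fix i
    have "i \<in> pverts ?B \<longleftrightarrow> (\<exists>k<p. i = 0 \<or> i = 1 \<or> i = k + 2)"
      unfolding book_graph_def pair_pre_digraph.simps by blast
    also have "\<dots> \<longleftrightarrow> i < p + 2"
    proof
      assume "i < p + 2"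
      then show "\<exists>k<p. i = 0 \<or> i = 1 \<or> i = k + 2"
        using p by (intro exI[of _ "i - 2"]) auto
    qed auto
    finally show "i \<in> pverts ?B \<longleftrightarrow> i \<in> {..<p + 2}" by simp
  qed
  have inj: "inj_on f (pverts ?B)"
    unfolding pvB
  proof (rule inj_onI)
    fix i j assume ij: "i \<in> {..<p + 2}" "j \<in> {..<p + 2}" "f i = f j"
    have ne: "g k \<noteq> u" "g k \<noteq> v" "u \<noteq> g k" "v \<noteq> g k" if "k < p" for k
      using gW[OF that] un by auto
    have cases: "l = 0 \<or> l = Suc 0 \<or> (\<exists>k<p. l = Suc (Suc k))" if "l < p + 2" for l
      using that by presburger
    have "i < p + 2" "j < p + 2" using ij by simp_all
    from cases[OF this(1)] cases[OF this(2)] ij(3) un(3) show "i = j"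
      by (elim disjE exE conjE) (auto simp: ne dest: g_inj)
  qed
  have vu: "(v, u) \<in> parcs G" using uv(1) G' by (auto dest: symD)
  have gk: "(u, g k) \<in> parcs G" "(v, g k) \<in> parcs G" "(g k, u) \<in> parcs G" "(g k, v) \<in> parcs G"
    if "k < p" for k
    using gW[OF that] W(1) G' by (auto dest: symD)
  have arcs: "(f i, f j) \<in> parcs G" if "(i, j) \<in> parcs ?B" for i j
    using that uv(1) vu gk by (auto simp: book_graph_def)
  \<comment> \<open>Only the arcs of the book are kept: \<open>W\<close> may span further arcs in
    \<open>G\<close>, so the induced subgraph would not do.\<close>
  define K where "K = \<lparr> pverts = f ` pverts ?B, parcs = map_prod f f ` parcs ?B \<rparr>"
  note B = pair_graph_book_graph[of p]
  interpret B: pair_graph ?B by (rule B)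
  note B' = B[unfolded pair_graph_iff]
  have K: "pair_graph K"
    unfolding pair_graph_iff
  proof (intro conjI allI)
    show "sym (parcs K)" using B' by (auto simp: K_def sym_def)
    show "(w, w) \<notin> parcs K" for w
    proof
      assume "(w, w) \<in> parcs K"
      then obtain i j where "(i, j) \<in> parcs ?B" "f i = w" "f j = w" by (auto simp: K_def)
      with arcs G' show False by metis
    qed
  qed (use B' in \<open>auto simp: K_def\<close>)
  have "subgraph (with_proj K) (with_proj G)"
  proof -
    interpret K: pair_graph K by fact
    have "pverts K \<subseteq> pverts G"
      using uv(1) G.in_arcsD1[OF gk(3)] G' by (auto simp: K_def book_graph_def)
    moreover have "parcs K \<subseteq> parcs G" using arcs by (auto simp: K_def)
    ultimately show ?thesis
      using K.wf_digraph G.wf_digraph by (auto simp: subgraph_def compatible_def)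
  qed
  moreover have "digraph_iso (with_proj ?B) (with_proj K)"
    unfolding digraph_iso_pair_iff[OF B K]
  proof (intro exI[of _ f] conjI ballI)
    show "bij_betw f (pverts ?B) (pverts K)" using inj by (auto simp: bij_betw_def K_def)
    fix i j assume ij: "i \<in> pverts ?B" "j \<in> pverts ?B"
    show "(i, j) \<in> parcs ?B \<longleftrightarrow> (f i, f j) \<in> parcs K"
    proof
      assume "(f i, f j) \<in> parcs K"
      then obtain i' j' where *: "(i', j') \<in> parcs ?B" "f i = f i'" "f j = f j'"
        by (auto simp: K_def)
      then have "i' \<in> pverts ?B" "j' \<in> pverts ?B" using B' by auto
      with * ij inj show "(i, j) \<in> parcs ?B" by (metis inj_onD)
    qed (force simp: K_def)
  qed
  then have "digraph_iso (with_proj K) (with_proj ?B)"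
    by (rule digraph_iso_swap[OF B.wf_digraph])
  ultimately show "contains_subgraph G ?B" by (auto simp: contains_subgraph_def)
qed


lemma complement_book_free_iff:
  assumes F: "pair_graph F" and n: "order_of F = p + 4" and p: "p \<ge> 1"
  shows "\<not> contains_subgraph (complement_graph F) (book_graph p) \<longleftrightarrow>
    (\<forall>x\<in>pverts F. \<forall>y\<in>pverts F. x \<noteq> y \<and> (x, y) \<notin> parcs F \<longrightarrow>
       3 \<le> card (parcs F `` {x} \<union> parcs F `` {y}))"
proof -
  let ?V = "pverts F" and ?E = "parcs F" and ?C = "parcs (complement_graph F)"
  have F': "finite ?V" "?E \<subseteq> ?V \<times> ?V" "sym ?E" "\<And>v. (v, v) \<notin> ?E"
    using F by (auto simp: pair_graph_iff)
  have common: "card (?C `` {x} \<inter> ?C `` {y}) + card (?E `` {x} \<union> ?E `` {y}) = p + 2"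
    if xy: "(x, y) \<in> ?C" for x y
  proof -
    have xy': "x \<in> ?V" "y \<in> ?V" "x \<noteq> y" "(x, y) \<notin> ?E" "(y, x) \<notin> ?E"
      using xy F'(3) by (auto simp: complement_graph_def dest: symD)
    \<comment> \<open>A third vertex is either adjacent in the complement to both \<open>x\<close>
      and \<open>y\<close>, or adjacent in \<open>F\<close> to at least one of them; this splits the
      other \<open>p + 2\<close> vertices.\<close>
    then have un: "(?C `` {x} \<inter> ?C `` {y}) \<union> (?E `` {x} \<union> ?E `` {y}) = ?V - {x, y}"
      using F' by (auto simp: complement_graph_def)
    have "finite ((?C `` {x} \<inter> ?C `` {y}) \<union> (?E `` {x} \<union> ?E `` {y}))"
      unfolding un using F'(1) by simp
    then have "card (?C `` {x} \<inter> ?C `` {y}) + card (?E `` {x} \<union> ?E `` {y}) = card (?V - {x, y})"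
      unfolding un[symmetric]
      by (intro card_Un_disjoint[symmetric]) (auto simp: complement_graph_def)
    then show ?thesis
      using xy' F'(1) n by (simp add: order_of_def card_Diff_subset)
  qed
  have "contains_subgraph (complement_graph F) (book_graph p) \<longleftrightarrow>
    (\<exists>x y. (x, y) \<in> ?C \<and> p \<le> card (?C `` {x} \<inter> ?C `` {y}))"
    by (rule contains_book_graph_iff[OF pair_graph_complement_graph[OF F] p])
  also have "\<dots> \<longleftrightarrow> (\<exists>x y. (x, y) \<in> ?C \<and> \<not> 3 \<le> card (?E `` {x} \<union> ?E `` {y}))"
    using common by (metis (no_types, lifting) add_le_cancel_left add_le_cancel_right not_less_eq_eq
      numeral_2_eq_2 numeral_3_eq_3)
  finally show ?thesis
    by (auto simp: complement_graph_def)
qed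

section \<open>The minimum degree sum and its equality case\<close>

text \<open>\<open>card E\<close> is the degree sum. It exceeds \<open>2 * card V - 2\<close> if no
  degree is below two or some vertex is isolated, so equality can come only from a vertex of degree
  one.\<close>

lemma arcs_lower_bound:
  fixes E :: "('a \<times> 'a) set"
  assumes V: "finite V" "E \<subseteq> V \<times> V" "card V \<ge> 2" and E: "sym E" "\<And>v. (v, v) \<notin> E"
    and nonadj: "\<And>x y. x \<in> V \<Longrightarrow> y \<in> V \<Longrightarrow> x \<noteq> y \<Longrightarrow> (x, y) \<notin> E \<Longrightarrow>
      3 \<le> card (E `` {x} \<union> E `` {y})"
  shows "2 * card V < card E + 2 \<or> card E + 2 = 2 * card V \<and>
    (\<exists>x\<in>V. \<exists>z\<in>V. x \<noteq> z \<and> E `` {x} = {z} \<and> E `` {z} = {x} \<and>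
       (\<forall>y\<in>V - {x, z}. card (E `` {y}) = 2))"
proof -
  let ?d = "\<lambda>v. card (E `` {v})"
  have fin: "finite (E `` {v})" for v
    using V by (meson finite_Image finite_SigmaI finite_subset)
  have cE: "card E = (\<Sum>v\<in>V. ?d v)" using V by (intro card_eq_sum_Image)
  consider "\<forall>v\<in>V. 2 \<le> ?d v" | x where "x \<in> V" "?d x = 0" | x where "x \<in> V" "?d x = 1"
    by (metis less_2_cases linorder_not_le One_nat_def)
  then show ?thesis
  proof cases
    case 1
    then have "(\<Sum>v\<in>V. 2) \<le> card E" unfolding cE by (intro sum_mono) auto
    then show ?thesis by simp
  next
    case (2 x)
    then have x: "E `` {x} = {}" using fin by simp
    have "3 \<le> ?d y" if "y \<in> V - {x}" for y
      using nonadj[of x y] 2 that x by auto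
    then have "(\<Sum>y\<in>V - {x}. 3) \<le> (\<Sum>y\<in>V - {x}. ?d y)" by (intro sum_mono)
    moreover have "card E = ?d x + (\<Sum>y\<in>V - {x}. ?d y)"
      unfolding cE using V 2 by (intro sum.remove) auto
    \<comment> \<open>\<open>3 * (card V - 1)\<close> exceeds \<open>2 * card V - 2\<close> because
      \<open>card V \<ge> 2\<close>.\<close>
    ultimately have "2 * card V < card E + 2" using V 2 by simp
    then show ?thesis ..
  next
    case (3 x)
    then obtain z where x: "E `` {x} = {z}" by (auto simp: card_1_singleton_iff)
    then have xz: "(x, z) \<in> E" by auto
    then have zx: "(z, x) \<in> E" and z: "z \<in> V" "x \<noteq> z" using V E by (auto dest: symD)
    let ?W = "V - {x, z}" and ?b = "\<lambda>y. if y \<in> E `` {z} then 1 else 0 :: nat"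
    \<comment> \<open>The neighbourhoods of \<open>x\<close> and \<open>y\<close> together are that
      of \<open>y\<close> with \<open>z\<close> added. If \<open>y\<close> is adjacent to
      \<open>z\<close>, adding \<open>z\<close> gains nothing, so the degree of \<open>y\<close>
      itself is at least three; this is the extra one in \<open>?b\<close>.\<close>
    have lower: "2 + ?b y \<le> ?d y" if y: "y \<in> ?W" for y
    proof -
      have "(x, y) \<notin> E" using x y by auto
      then have "3 \<le> card (insert z (E `` {y}))" using nonadj[of x y] x y 3 by auto
      moreover have "z \<in> E `` {y}" if "y \<in> E `` {z}" using that E by (auto dest: symD)
      ultimately show ?thesis using fin[of y] by (auto simp: card_insert_if insert_absorb split: if_splits)
    qed
    have cW: "card ?W = card V - 2" using V z 3 by (simp add: card_Diff_subset)
    have "(\<Sum>y\<in>?W. 2 + ?b y) = 2 * card ?W + card (?W \<inter> E `` {z})"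
      using V by (simp add: sum.distrib sum.If_cases del: Image_singleton_iff add_2_eq_Suc)
    also have "?W \<inter> E `` {z} = E `` {z} - {x}" using V E by auto
    also have "card (E `` {z} - {x}) = ?d z - 1" using zx fin by (simp add: card_Diff_subset)
    finally have sumb: "(\<Sum>y\<in>?W. 2 + ?b y) = 2 * card ?W + (?d z - 1)" .
    have split: "card E = 1 + ?d z + (\<Sum>y\<in>?W. ?d y)"
    proof -
      have "card E = (\<Sum>v\<in>?W. ?d v) + (\<Sum>v\<in>{x, z}. ?d v)"
        unfolding cE using V z 3 by (intro sum.subset_diff) auto
      then show ?thesis using z x by simp
    qed
    \<comment> \<open>With \<open>d\<close> the degree of \<open>z\<close>, the total is at least
      \<open>1 + d + 2 * (card V - 2) + (d - 1)\<close>, which is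
      \<open>2 * card V - 4 + 2 * d\<close>.\<close>
    have mono: "(\<Sum>y\<in>?W. 2 + ?b y) \<le> (\<Sum>y\<in>?W. ?d y)" using lower by (intro sum_mono)
    have d1: "1 \<le> ?d z" using zx fin[of z]
      by (metis Image_singleton_iff One_nat_def Suc_leI card_gt_0_iff empty_iff)
    show ?thesis
    proof (cases "?d z = 1 \<and> (\<forall>y\<in>?W. ?d y = 2)")
      case True
      then have "E `` {z} = {x}" using zx by (metis Image_singleton_iff card_1_singletonE singletonD)
      moreover have "card E + 2 = 2 * card V"
        using True split cW V by simp
      ultimately show ?thesis using True x z 3 by blast
    next
      case False
      \<comment> \<open>Equality fails in one of two ways: a degree above two in \<open>?W\<close>
        makes the sum there strictly larger, while \<open>?d z \<ge> 2\<close> lifts the total to at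
        least \<open>2 * card V\<close>.\<close>
      have "2 * card V < card E + 2"
      proof (cases "?d z = 1")
        case True
        with False obtain y where y: "y \<in> ?W" "?d y \<noteq> 2" by auto
        have two: "2 \<le> ?d y" if "y \<in> ?W" for y using add_leD1[OF lower[OF that]] .
        then have "2 < ?d y" using y by (metis le_neq_implies_less)
        with y two have "(\<Sum>y\<in>?W. 2) < (\<Sum>y\<in>?W. ?d y)"
          using V(1) by (intro sum_strict_mono_ex1 ballI bexI[of _ y]) auto
        then show ?thesis using True split cW V by simp
      next
        case False
        then show ?thesis using mono sumb split cW V d1 by simp
      qed
      then show ?thesis ..
    qed
  qed
qed

section \<open>Decomposing a 2-regular graph into cycles\<close>

text \<open>Compares \<open>G\<close> with the restriction of \<open>E\<close> to \<open>V\<close>.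
  Keeping \<open>V\<close> apart from \<open>E\<close> lets cycles be cut off from \<open>V\<close>
  while \<open>E\<close> stays fixed.\<close>

definition iso_rel :: "'a set \<Rightarrow> ('a \<times> 'a) set \<Rightarrow> 'b pair_pre_digraph \<Rightarrow> bool" where
  "iso_rel V E G \<longleftrightarrow> (\<exists>f. bij_betw f V (pverts G) \<and>
     (\<forall>u\<in>V. \<forall>v\<in>V. (u, v) \<in> E \<longleftrightarrow> (f u, f v) \<in> parcs G))"

text \<open>Prepending \<open>G\<close> gives it tag \<open>0\<close> and raises the other tags by
  one, so the isomorphism pairs \<open>g\<close> with \<open>0\<close> on \<open>A\<close> and
  follows \<open>h\<close> by the shift \<open>?s\<close> on \<open>B\<close>.\<close>

lemma iso_rel_disjoint_union_Cons:
  assumes A: "iso_rel A E G" and B: "iso_rel B E (disjoint_union Gs)"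
    and disj: "A \<inter> B = {}" "\<And>a b. a \<in> A \<Longrightarrow> b \<in> B \<Longrightarrow> (a, b) \<notin> E \<and> (b, a) \<notin> E"
  shows "iso_rel (A \<union> B) E (disjoint_union (G # Gs))"
proof -
  let ?D = "disjoint_union (G # Gs)" and ?D' = "disjoint_union Gs"
  let ?s = "\<lambda>x. (Suc (fst x), snd x)"
  obtain g where g: "bij_betw g A (pverts G)"
    and gE: "\<And>u v. u \<in> A \<Longrightarrow> v \<in> A \<Longrightarrow> (u, v) \<in> E \<longleftrightarrow> (g u, g v) \<in> parcs G"
    using A by (auto simp: iso_rel_def)
  obtain h where h: "bij_betw h B (pverts ?D')"
    and hE: "\<And>u v. u \<in> B \<Longrightarrow> v \<in> B \<Longrightarrow> (u, v) \<in> E \<longleftrightarrow> (h u, h v) \<in> parcs ?D'"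
    using B by (auto simp: iso_rel_def)
  define f where "f x = (if x \<in> A then (0, g x) else ?s (h x))" for x
  have pv: "pverts ?D = Pair 0 ` pverts G \<union> ?s ` pverts ?D'"
    by (force simp: disjoint_union_def image_iff less_Suc_eq_0_disj)
  have p0: "((0, a), (0, b)) \<in> parcs ?D \<longleftrightarrow> (a, b) \<in> parcs G" for a b
    by (auto simp: disjoint_union_def)
  have pS: "(?s a, ?s b) \<in> parcs ?D \<longleftrightarrow> (a, b) \<in> parcs ?D'" for a b
    by (cases a; cases b) (auto simp: disjoint_union_def)
  have pm: "((0, a), ?s b) \<notin> parcs ?D" "(?s b, (0, a)) \<notin> parcs ?D" for a b
    by (auto simp: disjoint_union_def)
  have "bij_betw f A (Pair 0 ` pverts G)"
  proof -
    have "bij_betw (\<lambda>x. (0 :: nat, g x)) A (Pair 0 ` pverts G)"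
      using g by (auto simp: bij_betw_def inj_on_def)
    then show ?thesis by (rule bij_betw_cong[THEN iffD1, rotated]) (simp add: f_def)
  qed
  moreover have "bij_betw f B (?s ` pverts ?D')"
  proof -
    have "bij_betw ?s (pverts ?D') (?s ` pverts ?D')"
      by (auto simp: bij_betw_def inj_on_def prod_eq_iff)
    from bij_betw_trans[OF h this] have "bij_betw (\<lambda>x. ?s (h x)) B (?s ` pverts ?D')"
      by (simp add: comp_def)
    then show ?thesis by (rule bij_betw_cong[THEN iffD1, rotated]) (use disj in \<open>auto simp: f_def\<close>)
  qed
  ultimately have "bij_betw f (A \<union> B) (pverts ?D)"
    unfolding pv by (rule bij_betw_combine) auto
  moreover have "(u, v) \<in> E \<longleftrightarrow> (f u, f v) \<in> parcs ?D" if "u \<in> A \<union> B" "v \<in> A \<union> B" for u v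
    using that disj gE hE p0 pS pm by (auto simp: f_def)
  ultimately show ?thesis unfolding iso_rel_def by blast
qed

text \<open>Finds one component. Giving each neighbourhood in full shows that the cycle has no
  chords and that no arc leaves it, so it can be removed from \<open>V\<close>.\<close>

lemma two_regular_cycle:
  fixes E :: "('a \<times> 'a) set"
  assumes V: "finite V" "V \<noteq> {}" and E: "sym E" "\<And>v. (v, v) \<notin> E"
    and reg: "\<And>v. v \<in> V \<Longrightarrow> E `` {v} \<subseteq> V \<and> card (E `` {v}) = 2"
  obtains w j where "j \<ge> 3" "inj_on w {..<j}" "w ` {..<j} \<subseteq> V"
    "\<And>i. i < j \<Longrightarrow> E `` {w i} = {w (Suc i mod j), w (if i = 0 then j - 1 else i - 1)}"
proof -
  have nb: "E `` {v} = {a, b}" if "v \<in> V" "(v, a) \<in> E" "(v, b) \<in> E" "a \<noteq> b" for v a b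
  proof -
    have "finite (E `` {v})" using reg[OF that(1)] V(1) by (meson finite_subset)
    then show ?thesis using reg[OF that(1)] that by (intro card_subset_eq[symmetric]) auto
  qed
  have other: "\<exists>c. (v, c) \<in> E \<and> c \<noteq> a" if v: "v \<in> V" for v a
  proof -
    obtain c d where "E `` {v} = {c, d}" "c \<noteq> d" using reg[OF v] by (auto simp: card_2_iff)
    then have "(v, c) \<in> E" "(v, d) \<in> E" by auto
    with \<open>c \<noteq> d\<close> show ?thesis by metis
  qed
  txt \<open>Follow a walk that never backtracks until it first meets itself: since every vertex on it has
    both its neighbours used up by the walk, the only vertex it can meet is the starting one.\<close>
  obtain v0 where v0: "v0 \<in> V" using V by auto
  obtain v1 where v1: "(v0, v1) \<in> E" using other[OF v0] by auto
  \<comment> \<open>The state of the walk is an arc, because not backtracking involves two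
    consecutive steps.\<close>
  let ?P = "\<lambda>e. fst e \<in> V \<and> e \<in> E" and ?Q = "\<lambda>e e'. fst e' = snd e \<and> snd e' \<noteq> fst e"
  have "\<exists>e. \<forall>n. (?P (e n) \<and> (n = 0 \<longrightarrow> e n = (v0, v1))) \<and> ?Q (e n) (e (Suc n))"
  proof (rule dependent_nat_choice)
    show "\<exists>e. ?P e \<and> (0 = (0::nat) \<longrightarrow> e = (v0, v1))" using v0 v1 by auto
    fix e :: "'a \<times> 'a" and n :: nat
    assume e: "?P e \<and> (n = 0 \<longrightarrow> e = (v0, v1))"
    then have "snd e \<in> V" using reg[of "fst e"] by (cases e) auto
    from other[OF this, of "fst e"] obtain c where "(snd e, c) \<in> E" "c \<noteq> fst e" by auto
    with \<open>snd e \<in> V\<close> show "\<exists>e'. (?P e' \<and> (Suc n = 0 \<longrightarrow> e' = (v0, v1))) \<and> ?Q e e'"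
      by (intro exI[of _ "(snd e, c)"]) auto
  qed
  then obtain e where e: "\<And>n. ?P (e n)" "\<And>n. ?Q (e n) (e (Suc n))" by blast
  define w where "w n = fst (e n)" for n
  have w: "w n \<in> V" "(w n, w (Suc n)) \<in> E" "w (Suc (Suc n)) \<noteq> w n" for n
    using e(1)[of n] e(2)[of n] e(2)[of "Suc n"] by (auto simp: w_def)
  have ws: "(w (Suc n), w n) \<in> E" for n using w(2) E(1) by (auto dest: symD)
  have nbS: "E `` {w (Suc n)} = {w n, w (Suc (Suc n))}" for n
    using nb[OF w(1) ws w(2)] w(3)[of n] by metis
  have "\<not> inj w"
    using V(1) w(1) by (metis finite_subset image_subsetI infinite_UNIV_nat finite_imageD)
  then have "\<exists>j. \<exists>i<j. w j = w i"
    unfolding inj_def by (metis linorder_neqE_nat)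
  \<comment> \<open>The first index at which the walk repeats a vertex, so \<open>w\<close> is
    injective below \<open>j\<close>.\<close>
  define j where "j = (LEAST j. \<exists>i<j. w j = w i)"
  have "\<exists>i<j. w j = w i" unfolding j_def by (rule LeastI_ex) fact
  then obtain i where i: "i < j" "w j = w i" by blast
  have least: "w k \<noteq> w l" if "l < k" "k < j" for k l
    using not_less_Least[of k "\<lambda>j. \<exists>i<j. w j = w i"] that unfolding j_def by blast
  have inj: "inj_on w {..<j}"
    using least by (intro inj_onI) (metis lessThan_iff linorder_neqE_nat)
  obtain j' where j': "j = Suc j'" using i by (cases j) auto
  \<comment> \<open>If \<open>i > 0\<close>, the neighbours of \<open>w i\<close> are
    \<open>w (i - 1)\<close> and \<open>w (i + 1)\<close>, and \<open>w (j - 1)\<close> is one of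
    them. The first contradicts the minimality of \<open>j\<close>; the second forces
    \<open>j = i + 2\<close>, hence \<open>w (i + 2) = w i\<close>, a backtrack.\<close>
  have "i = 0"
  proof (rule ccontr)
    assume "i \<noteq> 0"
    then obtain i' where i': "i = Suc i'" by (cases i) auto
    have "w j' \<in> E `` {w i}" using ws[of j'] i j' by simp
    then consider "w j' = w i'" | "w j' = w (Suc i)" using nbS[of i'] i' by auto
    then show False
    proof cases
      case 1
      then show False using least[of i' j'] i i' j' by auto
    next
      case 2
      have "Suc i < j" using i w(2)[of i] E(2) by (metis Suc_lessI)
      then have "j' = Suc i" using 2 inj j' by (auto simp: inj_on_def)
      then show False using w(3)[of i] i j' by auto
    qed
  qed
  then have j0: "w j = w 0" using i by simp
  \<comment> \<open>\<open>j = 1\<close> would give a loop and \<open>j = 2\<close> a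
    backtrack.\<close>
  have "j \<noteq> 1" "j \<noteq> 2" using j0 w(2)[of 0] w(3)[of 0] E(2) by (auto simp: numeral_2_eq_2)
  with i have j3: "j \<ge> 3" by auto
  have nb0: "E `` {w 0} = {w 1, w (j - 1)}"
  proof (rule nb)
    show "(w 0, w (j - 1)) \<in> E" using ws[of j'] j0 j' by simp
    have "1 < j - 1" "j - 1 < j" using j3 by linarith+
    then show "w 1 \<noteq> w (j - 1)" using least by metis
  qed (use w w(2)[of 0] in auto)
  have "E `` {w k} = {w (Suc k mod j), w (if k = 0 then j - 1 else k - 1)}" if "k < j" for k
  proof (cases k)
    case 0
    then show ?thesis using nb0 j3 by simp
  next
    case (Suc k')
    have "w (Suc k mod j) = w (Suc k)"
      using that j0 by (cases "Suc k = j") auto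
    then show ?thesis using nbS[of k'] Suc by auto
  qed
  then show ?thesis using that j3 inj w(1) by blast
qed

text \<open>Induction on \<open>V\<close>, splitting off one cycle at a time. Two neighbourhoods of
  size two have at least three elements together exactly if they differ; in this form the condition
  on non-adjacent vertices passes to the rest of \<open>V\<close>.\<close>

lemma two_regular_iso_cycles:
  fixes E :: "('a \<times> 'a) set"
  assumes V: "finite V" and E: "sym E" "\<And>v. (v, v) \<notin> E"
    and "\<And>v. v \<in> V \<Longrightarrow> E `` {v} \<subseteq> V \<and> card (E `` {v}) = 2"
    and "\<And>x y. x \<in> V \<Longrightarrow> y \<in> V \<Longrightarrow> x \<noteq> y \<Longrightarrow> (x, y) \<notin> E \<Longrightarrow> E `` {x} \<noteq> E `` {y}"
  shows "\<exists>cs. (\<forall>c\<in>set cs. c \<ge> 3 \<and> c \<noteq> 4) \<and> sum_list cs = card V \<and>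
    iso_rel V E (disjoint_union (map cycle_graph cs))"
  using V assms(4,5)
proof (induction V rule: finite_psubset_induct)
  case (psubset V)
  show ?case
  proof (cases "V = {}")
    case True
    then show ?thesis
      by (intro exI[of _ "[]"]) (auto simp: iso_rel_def disjoint_union_def bij_betw_def)
  next
    case False
    obtain w j where j: "j \<ge> 3" and inj: "inj_on w {..<j}" and wV: "w ` {..<j} \<subseteq> V"
      and nb: "\<And>i. i < j \<Longrightarrow> E `` {w i} = {w (Suc i mod j), w (if i = 0 then j - 1 else i - 1)}"
      by (rule two_regular_cycle[OF psubset.hyps False E]) (erule psubset.prems(1), rule that)
    let ?C = "w ` {..<j}"
    have closed: "E `` {v} \<subseteq> ?C" if "v \<in> ?C" for v
      using that nb j by force
    have apart: "(a, b) \<notin> E \<and> (b, a) \<notin> E" if "a \<in> ?C" "b \<in> V - ?C" for a b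
      using closed[OF that(1)] that(2) E(1) by (auto dest: symD)
    have "\<exists>cs. (\<forall>c\<in>set cs. c \<ge> 3 \<and> c \<noteq> 4) \<and> sum_list cs = card (V - ?C) \<and>
      iso_rel (V - ?C) E (disjoint_union (map cycle_graph cs))"
    proof (rule psubset.IH)
      have "w 0 \<in> ?C" using j by auto
      then show "V - ?C \<subset> V" using wV by blast
      show "E `` {v} \<subseteq> V - ?C \<and> card (E `` {v}) = 2" if "v \<in> V - ?C" for v
        using psubset.prems(1)[of v] that apart by blast
    qed (use psubset.prems(2) in auto)
    then obtain cs where cs: "\<forall>c\<in>set cs. c \<ge> 3 \<and> c \<noteq> 4" "sum_list cs = card (V - ?C)"
      "iso_rel (V - ?C) E (disjoint_union (map cycle_graph cs))" by blast
    have arc: "(w i, w k) \<in> E \<longleftrightarrow> k = Suc i mod j \<or> i = Suc k mod j" if ik: "i < j" "k < j" for i k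
    proof -
      have "(w i, w k) \<in> E \<longleftrightarrow> w k = w (Suc i mod j) \<or> w k = w (if i = 0 then j - 1 else i - 1)"
        using nb[OF ik(1)] by blast
      also have "\<dots> \<longleftrightarrow> k = Suc i mod j \<or> k = (if i = 0 then j - 1 else i - 1)"
        using ik by (simp add: inj_on_eq_iff[OF inj])
      also have "k = (if i = 0 then j - 1 else i - 1) \<longleftrightarrow> i = Suc k mod j"
        using ik by (cases "Suc k = j") auto
      finally show ?thesis .
    qed
    have "iso_rel ?C E (cycle_graph j)"
      unfolding iso_rel_def
    proof (intro exI conjI ballI)
      show bij: "bij_betw (inv_into {..<j} w) ?C (pverts (cycle_graph j))"
        using inj by (auto simp: cycle_graph_def intro: inj_on_imp_bij_betw bij_betw_inv_into)
      fix u v assume "u \<in> ?C" "v \<in> ?C"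
      then obtain i k where "i < j" "u = w i" "k < j" "v = w k" by auto
      then show "(u, v) \<in> E \<longleftrightarrow> (inv_into {..<j} w u, inv_into {..<j} w v) \<in> parcs (cycle_graph j)"
        using arc inj by (simp add: cycle_graph_def)
    qed
    then have "iso_rel (?C \<union> (V - ?C)) E (disjoint_union (cycle_graph j # map cycle_graph cs))"
      using cs(3) by (rule iso_rel_disjoint_union_Cons) (use apart in auto)
    then have "iso_rel V E (disjoint_union (map cycle_graph (j # cs)))"
      using wV by (simp add: Un_absorb1)
    \<comment> \<open>In a 4-cycle the opposite vertices \<open>w 0\<close> and \<open>w 2\<close>
      share both neighbours \<open>w 1\<close> and \<open>w 3\<close>.\<close>
    moreover have "j \<noteq> 4"
    proof
      assume 4: "j = 4"
      have "E `` {w 0} = E `` {w 2}" using nb[of 0] nb[of 2] 4 by auto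
      moreover have "(w 0, w 2) \<notin> E" using arc[of 0 2] 4 by auto
      moreover have "w 0 \<noteq> w 2" using inj_onD[OF inj, of 0 2] 4 by auto
      moreover have "w 0 \<in> V" "w 2 \<in> V" using wV 4 by auto
      ultimately show False using psubset.prems(2) by blast
    qed
    moreover have "card ?C = j" using inj by (simp add: card_image)
    then have "j + card (V - ?C) = card V"
      using wV psubset.hyps by (metis card_Diff_subset card_mono finite_imageI finite_lessThan le_add_diff_inverse)
    ultimately show ?thesis
      using j cs by (intro exI[of _ "j # cs"]) auto
  qed
qed

section \<open>Arc counts of disjoint unions and cycles\<close>

lemma card_parcs_disjoint_union:
  assumes "\<And>G. G \<in> set Gs \<Longrightarrow> pair_graph G"
  shows "card (parcs (disjoint_union Gs)) = (\<Sum>G\<leftarrow>Gs. card (parcs G))"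
  using assms
proof (induction Gs)
  case Nil
  then show ?case by (simp add: disjoint_union_def)
next
  case (Cons G Gs)
  let ?s = "\<lambda>x. (Suc (fst x), snd x)" and ?D = "disjoint_union Gs"
  have fin: "finite (parcs K)" if "pair_graph K" for K :: "'b pair_pre_digraph"
    using that unfolding pair_graph_iff by (meson finite_SigmaI finite_subset)
  have "parcs (disjoint_union (G # Gs)) =
    map_prod (Pair 0) (Pair 0) ` parcs G \<union> map_prod ?s ?s ` parcs ?D"
    by (force simp: disjoint_union_def image_iff less_Suc_eq_0_disj)
  also have "card \<dots> = card (map_prod (Pair (0::nat)) (Pair (0::nat)) ` parcs G)
      + card (map_prod ?s ?s ` parcs ?D)"
    using Cons.prems by (intro card_Un_disjoint finite_imageI fin pair_graph_disjoint_union) auto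
  also have "\<dots> = card (parcs G) + card (parcs ?D)"
    by (intro arg_cong2[where f = "(+)"] card_image) (auto simp: inj_on_def prod_eq_iff)
  finally show ?case using Cons by simp
qed

lemma card_parcs_complete_graph_2: "card (parcs (complete_graph 2)) = 2"
proof -
  have "parcs (complete_graph 2) = {(0, 1), (1, 0)}"
    by (auto simp: complete_graph_def numeral_2_eq_2 less_Suc_eq)
  then show ?thesis by simp
qed

text \<open>Forward and backward arcs number \<open>s\<close> each, and they are disjoint because
  \<open>s \<ge> 3\<close>; for \<open>s = 2\<close> they would coincide.\<close>

lemma card_parcs_cycle_graph:
  assumes s: "s \<ge> 3"
  shows "card (parcs (cycle_graph s)) = 2 * s"
proof -
  let ?A = "(\<lambda>u. (u, Suc u mod s)) ` {..<s}" and ?B = "(\<lambda>u. (Suc u mod s, u)) ` {..<s}"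
  have Suc: "Suc u mod s = (if Suc u = s then 0 else Suc u)" if "u < s" for u
    using that by auto
  have "parcs (cycle_graph s) = ?A \<union> ?B"
    using s by (auto simp: cycle_graph_def)
  also have "card \<dots> = card ?A + card ?B"
    using s by (intro card_Un_disjoint) (auto simp: Suc split: if_splits)
  also have "card ?A = s" by (simp add: card_image inj_on_def)
  also have "card ?B = s" by (simp add: card_image inj_on_def)
  finally show ?thesis by simp
qed

section \<open>The value of the extremal number\<close>

text \<open>The witness is the complement of K_2 + C_{p+2}, with the single edge on
  \<open>p + 2\<close> and \<open>p + 3\<close>. It lives on an initial segment of
  \<open>nat\<close>, the vertex type in \<open>ex_number\<close>, where
  \<open>disjoint_union\<close> would give tagged vertices.\<close>

lemma extremal_graph_exists:
  assumes p: "p \<ge> 3"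
  obtains G :: "nat pair_pre_digraph" where "pair_graph G" "order_of G = p + 4"
    "\<not> contains_subgraph G (book_graph p)" "2 * size_of G = (p + 3) * (p + 2)"
proof -
  let ?s = "p + 2"
  define F :: "nat pair_pre_digraph" where "F = \<lparr> pverts = {..<p + 4},
    parcs = parcs (cycle_graph ?s) \<union> {(p + 2, p + 3), (p + 3, p + 2)} \<rparr>"
  have cyc: "pair_graph (cycle_graph ?s)" using p by (intro pair_graph_cycle_graph) simp
  have sub: "parcs (cycle_graph ?s) \<subseteq> {..<?s} \<times> {..<?s}" by (auto simp: cycle_graph_def)
  have F: "pair_graph F"
    using cyc sub by (auto simp: pair_graph_iff F_def sym_def)
  have n: "order_of F = p + 4" by (simp add: order_of_def F_def)
  have fin: "finite (parcs (cycle_graph ?s))"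
    using sub by (meson finite_SigmaI finite_lessThan finite_subset)
  have "card (parcs F) = card (parcs (cycle_graph ?s)) + card {(p + 2, p + 3), (p + 3, p + 2)}"
    unfolding F_def pair_pre_digraph.simps using fin sub by (intro card_Un_disjoint) auto
  then have cF: "card (parcs F) = 2 * (p + 3)"
    using p by (simp add: card_parcs_cycle_graph)
  let ?N = "\<lambda>v. parcs F `` {v}"
  \<comment> \<open>Successor and predecessor on the cycle, freed of \<open>mod\<close> for case
    analysis.\<close>
  define a where "a v = (if Suc v = ?s then 0 else Suc v)" for v
  define b where "b v = (if v = 0 then p + 1 else v - 1)" for v
  have md: "Suc v mod ?s = a v" if "v < ?s" for v
    using that by (cases "Suc v = ?s") (auto simp: a_def)
  have Nc: "?N v = {a v, b v}" if "v < ?s" for v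
  proof -
    have "(v, u) \<in> parcs (cycle_graph ?s) \<longleftrightarrow> u = a v \<or> u = b v" for u
      using that p md[of u] md[of v] unfolding cycle_graph_def
      by (cases "u < ?s") (auto simp: a_def b_def split: if_splits)
    moreover have "?N v = parcs (cycle_graph ?s) `` {v}" using that by (auto simp: F_def)
    ultimately show ?thesis by blast
  qed
  have Ne: "?N (p + 2) = {p + 3}" "?N (p + 3) = {p + 2}" using sub by (auto simp: F_def)
  have ab: "a v \<noteq> b v" "a v < ?s" "b v < ?s" if "v < ?s" for v
    using that p by (auto simp: a_def b_def)
  have three: "3 \<le> card A" if "finite A" "{x, y, z} \<subseteq> A" "x \<noteq> y" "x \<noteq> z" "y \<noteq> z" for A and x y z :: nat
    using card_mono[OF that(1,2)] that by simp
  have "3 \<le> card (?N x \<union> ?N y)"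
    if "x < p + 4" "y < p + 4" "x < y" "(x, y) \<notin> parcs F" for x y
  proof (cases "y < ?s")
    case True
    then have x: "x < ?s" using that by simp
    \<comment> \<open>The neighbourhoods differ: \<open>a y = b x\<close> and
      \<open>b y = a x\<close> together would give \<open>4 = 0\<close> modulo \<open>p + 2\<close>,
      which \<open>p \<ge> 3\<close> rules out.\<close>
    have "a y \<noteq> a x" "b y \<noteq> b x" "a y \<noteq> b x \<or> b y \<noteq> a x"
      using True that p by (auto simp: a_def b_def split: if_splits)
    then obtain z where "z \<in> {a y, b y}" "z \<noteq> a x" "z \<noteq> b x" by blast
    then show ?thesis using ab[OF x] unfolding Nc[OF x] Nc[OF True]
      by (intro three[of _ "a x" "b x" z]) auto
  next
    case False
    \<comment> \<open>Here \<open>y\<close> is an end of the single edge. As \<open>x < y\<close> is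
      not adjacent to \<open>y\<close>, it lies on the cycle, and the one neighbour of
      \<open>y\<close> lies off the cycle, a third element besides \<open>a x\<close> and
      \<open>b x\<close>.\<close>
    then have y: "y = p + 2 \<or> y = p + 3" using that by auto
    with that have x: "x < ?s" by (auto simp: F_def less_Suc_eq)
    from y obtain z where "?N y = {z}" "z \<ge> ?s" using Ne by auto
    then show ?thesis using ab[OF x] unfolding Nc[OF x]
      by (intro three[of _ "a x" "b x" z]) auto
  qed
  moreover have "sym (parcs F)" using F by (simp add: pair_graph_iff)
  ultimately have "3 \<le> card (?N x \<union> ?N y)"
    if "x < p + 4" "y < p + 4" "x \<noteq> y" "(x, y) \<notin> parcs F" for x y
    using that by (metis Un_commute linorder_neqE_nat symD)
  then have "\<not> contains_subgraph (complement_graph F) (book_graph p)"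
    using complement_book_free_iff[OF F n] p by (auto simp: F_def)
  \<comment> \<open>The arcs number \<open>(p + 4) * (p + 3) - 2 * (p + 3)\<close>.\<close>
  moreover have "2 * size_of (complement_graph F) = (p + 3) * (p + 2)"
    using card_parcs_complement_graph[OF F] card_parcs[OF pair_graph_complement_graph[OF F]]
    by (simp add: n cF algebra_simps)
  moreover have "order_of (complement_graph F) = p + 4"
    using n by (simp add: order_of_def complement_graph_def)
  ultimately show ?thesis using that pair_graph_complement_graph[OF F] by blast
qed

text \<open>These facts serve twice: for hosts over \<open>nat\<close> they bound
  \<open>ex_number\<close>, and for \<open>H\<close> over any type they give its structure.\<close>

lemma book_free_complement:
  fixes H :: "'a pair_pre_digraph"
  assumes p: "p \<ge> 3" and H: "pair_graph H" "order_of H = p + 4"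
    and free: "\<not> contains_subgraph H (book_graph p)"
  defines "E \<equiv> parcs (complement_graph H)"
  shows "2 * size_of H + card E = (p + 4) * (p + 3)"
    and "2 * (p + 3) < card E \<or> card E = 2 * (p + 3) \<and>
      (\<exists>x\<in>pverts H. \<exists>z\<in>pverts H. x \<noteq> z \<and> E `` {x} = {z} \<and> E `` {z} = {x} \<and>
        (\<forall>y\<in>pverts H - {x, z}. card (E `` {y}) = 2))"
    and "\<lbrakk>x \<in> pverts H; y \<in> pverts H; x \<noteq> y; (x, y) \<notin> E\<rbrakk> \<Longrightarrow> 3 \<le> card (E `` {x} \<union> E `` {y})"
proof -
  let ?F = "complement_graph H"
  have F: "pair_graph ?F" using H by (intro pair_graph_complement_graph)
  have V: "pverts ?F = pverts H" by (simp add: complement_graph_def)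
  have n: "order_of ?F = p + 4" using H V by (simp add: order_of_def)
  have "\<not> contains_subgraph (complement_graph ?F) (book_graph p)"
    using free H by (simp add: complement_graph_complement_graph)
  then have *: "3 \<le> card (E `` {x} \<union> E `` {y})"
    if "x \<in> pverts H" "y \<in> pverts H" "x \<noteq> y" "(x, y) \<notin> E" for x y
    using complement_book_free_iff[OF F n] p V that by (auto simp: E_def)
  then show "\<lbrakk>x \<in> pverts H; y \<in> pverts H; x \<noteq> y; (x, y) \<notin> E\<rbrakk> \<Longrightarrow> 3 \<le> card (E `` {x} \<union> E `` {y})" .
  show "2 * size_of H + card E = (p + 4) * (p + 3)"
    using card_parcs_complement_graph[OF H(1)] card_parcs[OF H(1)] H(2) by (simp add: E_def)
  have "card (pverts H) = p + 4" using H by (simp add: order_of_def)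
  then show "2 * (p + 3) < card E \<or> card E = 2 * (p + 3) \<and>
      (\<exists>x\<in>pverts H. \<exists>z\<in>pverts H. x \<noteq> z \<and> E `` {x} = {z} \<and> E `` {z} = {x} \<and>
        (\<forall>y\<in>pverts H - {x, z}. card (E `` {y}) = 2))"
    using arcs_lower_bound[of "pverts H" E] F * unfolding pair_graph_iff V E_def[symmetric] by auto
qed

text \<open>Doubled to avoid division. The witness attains the value, and the lower bound on arcs of
  the complement limits every other host.\<close>

lemma ex_number_book_graph:
  assumes p: "p \<ge> 3"
  shows "2 * ex_number (p + 4) (book_graph p) = (p + 3) * (p + 2)"
proof -
  let ?S = "{size_of G | G :: nat pair_pre_digraph.
     pair_graph G \<and> order_of G = p + 4 \<and> \<not> contains_subgraph G (book_graph p)}"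
  obtain G :: "nat pair_pre_digraph" where G: "pair_graph G" "order_of G = p + 4"
    "\<not> contains_subgraph G (book_graph p)" "2 * size_of G = (p + 3) * (p + 2)"
    using extremal_graph_exists[OF p] .
  have le: "m \<le> size_of G" if m: "m \<in> ?S" for m
  proof -
    obtain K :: "nat pair_pre_digraph" where K: "m = size_of K" "pair_graph K" "order_of K = p + 4"
      "\<not> contains_subgraph K (book_graph p)" using m by blast
    have "2 * m \<le> (p + 3) * (p + 2)"
      using book_free_complement(1,2)[OF p K(2-4)] K(1) by (auto simp: algebra_simps)
    then show ?thesis using G(4) by simp
  qed
  have "Max ?S = size_of G"
  proof (rule Max_eqI)
    \<comment> \<open>\<open>Max\<close> is meaningful only on a finite set; the upper bound
      supplies finiteness.\<close>
    show "finite ?S" using le by (meson finite_nat_set_iff_bounded_le)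
  qed (use le G in auto)
  then show ?thesis using G(4) by (simp add: ex_number_def)
qed

section \<open>The structure of the extremal graphs\<close>

theorem theorem7:
  fixes p :: nat and H :: "'a pair_pre_digraph"
  assumes "p \<ge> 3"
    and "pair_graph H"
    and "order_of H = p + 4"
    and "\<not> contains_subgraph H (book_graph p)"
  shows "size_of H = ex_number (p + 4) (book_graph p) \<longleftrightarrow>
    (\<exists>cs :: nat list. (\<forall>c\<in>set cs. c \<ge> 3 \<and> c \<noteq> 4) \<and> sum_list cs = p + 2 \<and>
      digraph_iso (with_proj H)
        (with_proj (complement_graph (disjoint_union (complete_graph 2 # map cycle_graph cs)))))"
    (is "_ \<longleftrightarrow> ?R")
proof -
  define E where "E = parcs (complement_graph H)"
  let ?V = "pverts H"
  let ?D = "\<lambda>cs. disjoint_union (complete_graph 2 # map cycle_graph cs)"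
  note H = book_free_complement[OF assms, folded E_def]
  have F: "finite ?V" "E \<subseteq> ?V \<times> ?V" "sym E" "\<And>v. (v, v) \<notin> E"
    using pair_graph_complement_graph[OF assms(2)]
    by (auto simp: pair_graph_iff E_def complement_graph_def)
  have cV: "card ?V = p + 4" using assms by (simp add: order_of_def)
  have HE: "(u, v) \<in> parcs H \<longleftrightarrow> u \<noteq> v \<and> (u, v) \<notin> E" if "u \<in> ?V" "v \<in> ?V" for u v
    using that assms(2) by (auto simp: E_def complement_graph_def pair_graph_iff)
  have D: "pair_graph (?D cs)" if "\<forall>c\<in>set cs. c \<ge> 3 \<and> c \<noteq> 4" for cs
    using that by (intro pair_graph_disjoint_union)
      (auto intro: pair_graph_complete_graph pair_graph_cycle_graph)
  \<comment> \<open>Twice the size of \<open>H\<close> and \<open>card E\<close> have a fixed sum,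
    so extremality turns into the least possible \<open>card E\<close>.\<close>
  have "size_of H = ex_number (p + 4) (book_graph p) \<longleftrightarrow> card E = 2 * (p + 3)"
    using H(1) ex_number_book_graph[OF assms(1)] by (auto simp: algebra_simps)
  also have "\<dots> \<longleftrightarrow> ?R"
  proof
    assume "card E = 2 * (p + 3)"
    then obtain x z where xz: "x \<in> ?V" "z \<in> ?V" "x \<noteq> z" "E `` {x} = {z}" "E `` {z} = {x}"
      and two: "\<And>y. y \<in> ?V - {x, z} \<Longrightarrow> card (E `` {y}) = 2"
      using H(2) by auto
    let ?W = "?V - {x, z}"
    have apart: "(a, b) \<notin> E \<and> (b, a) \<notin> E" if "a \<in> {x, z}" "b \<in> ?W" for a b
      using that xz F(3) by (auto dest: symD)
    have "\<exists>cs. (\<forall>c\<in>set cs. c \<ge> 3 \<and> c \<noteq> 4) \<and> sum_list cs = card ?W \<and>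
      iso_rel ?W E (disjoint_union (map cycle_graph cs))"
    proof (rule two_regular_iso_cycles)
      show "E `` {v} \<subseteq> ?W \<and> card (E `` {v}) = 2" if "v \<in> ?W" for v
        using that two[OF that] F apart by blast
      \<comment> \<open>Equal neighbourhoods of size two would have a union of size two, below the
        required three.\<close>
      show "E `` {a} \<noteq> E `` {b}" if "a \<in> ?W" "b \<in> ?W" "a \<noteq> b" "(a, b) \<notin> E" for a b
        using H(3)[of a b] two[of a] that by force
    qed (use F in auto)
    then obtain cs where cs: "\<forall>c\<in>set cs. c \<ge> 3 \<and> c \<noteq> 4" "sum_list cs = card ?W"
      "iso_rel ?W E (disjoint_union (map cycle_graph cs))" by blast
    have "iso_rel {x, z} E (complete_graph 2)"
      unfolding iso_rel_def
      using xz F(4) by (intro exI[of _ "\<lambda>v. if v = x then 0 else 1"])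
        (auto simp: complete_graph_def bij_betw_def inj_on_def)
    then have "iso_rel ({x, z} \<union> ?W) E (?D cs)"
      using cs(3) by (rule iso_rel_disjoint_union_Cons) (use apart in auto)
    moreover have "{x, z} \<union> ?W = ?V" using xz by auto
    ultimately obtain f where f: "bij_betw f ?V (pverts (?D cs))"
      and fE: "\<And>u v. u \<in> ?V \<Longrightarrow> v \<in> ?V \<Longrightarrow> (u, v) \<in> E \<longleftrightarrow> (f u, f v) \<in> parcs (?D cs)"
      by (auto simp: iso_rel_def)
    have "digraph_iso (with_proj H) (with_proj (complement_graph (?D cs)))"
      unfolding digraph_iso_pair_iff[OF assms(2) pair_graph_complement_graph[OF D[OF cs(1)]]]
    proof (intro exI conjI ballI)
      show "bij_betw f ?V (pverts (complement_graph (?D cs)))"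
        using f by (simp add: complement_graph_def)
      fix u v assume uv: "u \<in> ?V" "v \<in> ?V"
      then have "f u \<in> pverts (?D cs)" "f v \<in> pverts (?D cs)" "f u = f v \<longleftrightarrow> u = v"
        using f by (auto simp: bij_betw_def inj_on_def)
      then show "(u, v) \<in> parcs H \<longleftrightarrow> (f u, f v) \<in> parcs (complement_graph (?D cs))"
        using HE[OF uv] fE[OF uv] by (simp add: complement_graph_def)
    qed
    moreover have "card ?W = p + 2" using cV xz F(1) by (simp add: card_Diff_subset)
    ultimately show ?R using cs by auto
  next
    \<comment> \<open>The converse is a count: \<open>f\<close> carries \<open>E\<close> bijectively
      onto the arcs of the disjoint union, where the single edge gives two and the cycles give twice
      their total length \<open>p + 2\<close>.\<close>
    assume ?R
    then obtain cs where cs: "\<forall>c\<in>set cs. c \<ge> 3 \<and> c \<noteq> 4" "sum_list cs = p + 2"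
      and iso: "digraph_iso (with_proj H) (with_proj (complement_graph (?D cs)))" by blast
    obtain f where f: "bij_betw f ?V (pverts (complement_graph (?D cs)))"
      and fH: "\<And>u v. u \<in> ?V \<Longrightarrow> v \<in> ?V \<Longrightarrow>
        (u, v) \<in> parcs H \<longleftrightarrow> (f u, f v) \<in> parcs (complement_graph (?D cs))"
      using iso digraph_iso_pair_iff[OF assms(2) pair_graph_complement_graph[OF D[OF cs(1)]]] by blast
    then have f': "inj_on f ?V" "f ` ?V = pverts (?D cs)"
      by (auto simp: bij_betw_def complement_graph_def)
    have pair_no_loop: "(a, a) \<notin> parcs (?D cs)" for a
      using D[OF cs(1)] unfolding pair_graph_iff by blast
    have "(u, v) \<in> E \<longleftrightarrow> (f u, f v) \<in> parcs (?D cs)" if uv: "u \<in> ?V" "v \<in> ?V" for u v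
    proof -
      have "f u \<in> pverts (?D cs)" "f v \<in> pverts (?D cs)" "f u = f v \<longleftrightarrow> u = v"
        using f' uv by (auto simp: inj_on_def)
      then show ?thesis
        using HE[OF uv] fH[OF uv] F(4)[of v] pair_no_loop[of "f v"]
        by (cases "u = v") (simp_all add: complement_graph_def)
    qed
    note fE = this
    have "parcs (?D cs) = map_prod f f ` E"
    proof (intro equalityI subsetI)
      fix e assume e: "e \<in> parcs (?D cs)"
      then have "e \<in> f ` ?V \<times> f ` ?V"
        using D[OF cs(1)] unfolding f'(2) pair_graph_iff by blast
      then obtain u v where "u \<in> ?V" "v \<in> ?V" "e = (f u, f v)" by blast
      with e fE show "e \<in> map_prod f f ` E" by force
    qed (use F(2) fE in auto)
    moreover have "inj_on (map_prod f f) E"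
      using map_prod_inj_on[OF f'(1) f'(1)] F(2) by (rule inj_on_subset)
    ultimately have "card E = card (parcs (?D cs))" by (simp add: card_image)
    also have "\<dots> = 2 + (\<Sum>c\<leftarrow>cs. card (parcs (cycle_graph c)))"
      using cs(1) by (subst card_parcs_disjoint_union)
        (auto intro: pair_graph_complete_graph pair_graph_cycle_graph
          simp: card_parcs_complete_graph_2 comp_def)
    also have "(\<Sum>c\<leftarrow>cs. card (parcs (cycle_graph c))) = (\<Sum>c\<leftarrow>cs. 2 * c)"
      using cs(1) by (intro arg_cong[where f = sum_list] map_cong) (auto simp: card_parcs_cycle_graph)
    also have "\<dots> = 2 * (p + 2)"
      using cs(2) by (simp add: sum_list_const_mult)
    finally show "card E = 2 * (p + 3)" by simp
  qed
  finally show ?thesis .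
qed

end
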